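(* Suppose $m:\mathcal{A}\to[0,+\infty)$ is a set function with $m(\emptyset)=0$ that is monotone, $\sigma$-subadditive and of finite variation, and let $f:T\to\mathbb{R}$ be a bounded function. Then $f$ is Gould $m$-integrable on $T$ if and only if $f$ is Riemann-Lebesgue $m$-integrable on $T$. In this case, the Gould integral $(G)\int_T f\,dm$ equals the Riemann-Lebesgue integral $(|RL|)\int_T f\,dm$.
   Context: $T$ is a nonempty, at least countable (i.e. infinite) set and $\mathcal{A}$ is a $\sigma$-algebra of subsets of $T$. The set function $m$ is monotone if $m(A)\le m(B)$ for all $A\subseteq B$ in $\mathcal{A}$; it is $\sigma$-subadditive if $m(\bigcup_{n=0}^{\infty}A_n)\le\sum_{n=0}^{\infty}m(A_n)$ for every sequence $(A_n)\subset\mathcal{A}$ of pairwise disjoint sets. The variation of $m$ is $\overline{m}(E)=\sup\{\sum_{i=1}^n m(A_i)\}$ for $E\subseteq T$, the supremum being over finite families of pairwise disjoint sets $A_i\in\mathcal{A}$ with $A_i\subseteq E$; $m$ is of finite variation if $\overline{m}(T)<+\infty$. A finite (respectively countable) partition of $T$ is a finite (respectively at most countable) family of pairwise disjoint nonempty sets of $\mathcal{A}$ with union $T$. For partitions $P,P'$ of $T$, write $P'\ge P$ if every set of $P'$ is included in some set of $P$. A function $f:T\to\mathbb{R}$ is Riemann-Lebesgue $m$-integrable on $T$ if there is $b\in\mathbb{R}$ such that for every $\varepsilon>0$ there is a countable partition $P_\varepsilon$ of $T$ such that for every countable partition $P=\{A_n\}$ of $T$ with $P\ge P_\varepsilon$: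 $f$ is bounded on every $A_n$ with $m(A_n)>0$, and for every choice of points $t_n\in A_n$ the series $\sum_n f(t_n)m(A_n)$ is absolutely convergent and $|\sum_n f(t_n)m(A_n)-b|<\varepsilon$. The number $b$ is unique and is denoted $(|RL|)\int_T f\,dm$. A function $f:T\to\mathbb{R}$ is Gould $m$-integrable on $T$ if there is $a\in\mathbb{R}$ such that for every $\varepsilon>0$ there is a finite partition $P_\varepsilon$ of $T$ such that for every finite partition $P=\{A_i\}_{i=1,\dots,n}$ of $T$ with $P\ge P_\varepsilon$ and every choice $t_i\in A_i$ one has $|\sum_{i=1}^n f(t_i)m(A_i)-a|<\varepsilon$. The number $a$ is denoted $(G)\int_T f\,dm$. *)

theory Defs
  imports "HOL-Analysis.Analysis"
begin

text \<open>
  Set functions \<open>m\<close> on a \<open>\<sigma>\<close>-algebra \<open>\<A>\<close> of subsets of \<open>T\<close> are plain functions \<open>'a set \<Rightarrow> real\<close>;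
  only their values on \<open>\<A>\<close> matter.  Likewise only the values of integrands on \<open>T\<close> matter.
\<close>

text \<open>
  The families are indexed, so sets may be repeated only if they are empty.  The value
  is an extended real because the supremum may be infinite; \<open>m\<close> is meant to be nonnegative.
\<close>

definition variation :: "'a set set \<Rightarrow> ('a set \<Rightarrow> real) \<Rightarrow> 'a set \<Rightarrow> ennreal" where
  "variation \<A> m E =
     (SUP (n, X) \<in> {(n :: nat, X :: nat \<Rightarrow> 'a set).
                      (\<forall>i<n. X i \<in> \<A> \<and> X i \<subseteq> E) \<and> disjoint_family_on X {..<n}}.
        \<Sum>i<n. ennreal (m (X i)))"

definition finite_variation :: "'a set \<Rightarrow> 'a set set \<Rightarrow> ('a set \<Rightarrow> real) \<Rightarrow> bool" where
  "finite_variation T \<A> m \<longleftrightarrow> variation \<A> m T < \<infinity>"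

definition finite_partition :: "'a set \<Rightarrow> 'a set set \<Rightarrow> 'a set set \<Rightarrow> bool" where
  "finite_partition T \<A> P \<longleftrightarrow> partition_on T P \<and> P \<subseteq> \<A> \<and> finite P"

definition countable_partition :: "'a set \<Rightarrow> 'a set set \<Rightarrow> 'a set set \<Rightarrow> bool" where
  "countable_partition T \<A> P \<longleftrightarrow> partition_on T P \<and> P \<subseteq> \<A> \<and> countable P"

text \<open>
  Since the members of a partition are nonempty and pairwise disjoint, a partition may be
  indexed by its own members: tags become a function \<open>t\<close> choosing a point of each
  member.  The series below are sums over a countable index set; for an absolutely
  convergent series this agrees with the sum along any enumeration.
\<close>

definition has_gould_integral ::
  "'a set \<Rightarrow> 'a set set \<Rightarrow> ('a set \<Rightarrow> real) \<Rightarrow> ('a \<Rightarrow> real) \<Rightarrow> real \<Rightarrow> bool" where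
  "has_gould_integral T \<A> m f a \<longleftrightarrow>
     (\<forall>\<epsilon>>0. \<exists>P\<^sub>\<epsilon>. finite_partition T \<A> P\<^sub>\<epsilon> \<and>
        (\<forall>P. finite_partition T \<A> P \<and> refines T P P\<^sub>\<epsilon> \<longrightarrow>
          (\<forall>t. (\<forall>X\<in>P. t X \<in> X) \<longrightarrow> \<bar>(\<Sum>X\<in>P. f (t X) * m X) - a\<bar> < \<epsilon>)))"

definition gould_integrable ::
  "'a set \<Rightarrow> 'a set set \<Rightarrow> ('a set \<Rightarrow> real) \<Rightarrow> ('a \<Rightarrow> real) \<Rightarrow> bool" where
  "gould_integrable T \<A> m f \<longleftrightarrow> (\<exists>a. has_gould_integral T \<A> m f a)"

definition gould_integral ::
  "'a set \<Rightarrow> 'a set set \<Rightarrow> ('a set \<Rightarrow> real) \<Rightarrow> ('a \<Rightarrow> real) \<Rightarrow> real" where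
  "gould_integral T \<A> m f = (THE a. has_gould_integral T \<A> m f a)"

definition has_RL_integral ::
  "'a set \<Rightarrow> 'a set set \<Rightarrow> ('a set \<Rightarrow> real) \<Rightarrow> ('a \<Rightarrow> real) \<Rightarrow> real \<Rightarrow> bool" where
  "has_RL_integral T \<A> m f b \<longleftrightarrow>
     (\<forall>\<epsilon>>0. \<exists>P\<^sub>\<epsilon>. countable_partition T \<A> P\<^sub>\<epsilon> \<and>
        (\<forall>P. countable_partition T \<A> P \<and> refines T P P\<^sub>\<epsilon> \<longrightarrow>
          (\<forall>X\<in>P. m X > 0 \<longrightarrow> bounded (f ` X)) \<and>
          (\<forall>t. (\<forall>X\<in>P. t X \<in> X) \<longrightarrow>
             (\<lambda>X. \<bar>f (t X) * m X\<bar>) summable_on P \<and>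
             \<bar>(\<Sum>\<^sub>\<infinity>X\<in>P. f (t X) * m X) - b\<bar> < \<epsilon>)))"

definition RL_integrable ::
  "'a set \<Rightarrow> 'a set set \<Rightarrow> ('a set \<Rightarrow> real) \<Rightarrow> ('a \<Rightarrow> real) \<Rightarrow> bool" where
  "RL_integrable T \<A> m f \<longleftrightarrow> (\<exists>b. has_RL_integral T \<A> m f b)"

definition RL_integral ::
  "'a set \<Rightarrow> 'a set set \<Rightarrow> ('a set \<Rightarrow> real) \<Rightarrow> ('a \<Rightarrow> real) \<Rightarrow> real" where
  "RL_integral T \<A> m f = (THE b. has_RL_integral T \<A> m f b)"

end

theory Submission
  imports Defs
begin

text \<open>
  Both integrals are limits of the sums \<open>S(P) = \<Sum>\<^sub>X f (t X) * m X\<close>, over finite partitions in one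
  case and countable partitions in the other.  The two limits agree because countable
  partitions differ from finite ones only by a small tail.  Finite variation bounds
  every finite sum \<open>\<Sum>m X\<close> over disjoint sets, so \<open>m\<close> is summable over each countable partition \<open>P\<close>,
  and all but finitely many members of \<open>P\<close> contribute at most \<open>\<delta>\<close>.  If \<open>\<bar>f\<bar> \<le> K\<close> and two tagged
  families share a part, then their sums differ by at most \<open>K\<close> times the total \<open>m\<close> outside that part
  (\<open>tagged_sums_diff_le\<close>), so it suffices to trade tails of small total \<open>m\<close>.

  From Gould to Riemann--Lebesgue: given a countable \<open>P\<close> that refines a good finite partition \<open>Q\<close>, keep
  finitely many members of \<open>P\<close> and merge the others inside each member of \<open>Q\<close>.  The result is a finite
  refinement of \<open>Q\<close>, and by \<open>\<sigma>\<close>-subadditivity the merged sets weigh no more than the tail did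
  (\<open>sum_merged_le\<close>).

  From Riemann--Lebesgue to Gould: here a good countable partition \<open>Q\<close> is collapsed to a finite one by
  merging its tail into a single set \<open>R\<close>.  A finite refinement of this may split \<open>R\<close> again, so smallness of
  the tail of \<open>Q\<close>, or of \<open>m R\<close>, is not enough: the variation of \<open>m\<close> on \<open>R\<close> must be small.  This holds once
  \<open>Q\<close> is so fine that \<open>\<Sum>\<^sub>Q m\<close> nearly exhausts the variation of \<open>m\<close> on the whole space, since then
  little is left to any disjoint family inside \<open>R\<close>.  Subadditivity makes \<open>\<Sum>\<^sub>P m\<close> grow under
  refinement, so every partition has refinements of this kind (\<open>refinement_near_variation\<close>).

  Neither direction changes the limit, so the two integrals are the same relation between \<open>f\<close>
  and a real number.
\<close>

section \<open>Summable functions and tagged sums\<close>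

lemma disjoint_Union_Diff:
  assumes "disjoint P" "F \<subseteq> P"
  shows "\<Union>F \<inter> \<Union>(P - F) = {}"
proof -
  have "X \<inter> Y = {}" if "X \<in> F" "Y \<in> P - F" for X Y
    using that assms by (intro disjointD[of P]) auto
  then show ?thesis by blast
qed

lemma Union_Un_Union_Diff:
  assumes "F \<subseteq> P"
  shows "\<Union>F \<union> \<Union>(P - F) = \<Union>P"
proof -
  have "F \<union> (P - F) = P"
    using assms by blast
  then show ?thesis
    by (metis Union_Un_distrib)
qed

lemma summable_on_small_tail:
  fixes g :: "'b \<Rightarrow> real"
  assumes "g summable_on P" "\<delta> > 0"
  obtains F where "finite F" "F \<subseteq> P" "infsum g (P - F) \<le> \<delta>"
    "infsum g P = sum g F + infsum g (P - F)"
proof -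
  obtain F where F: "finite F" "F \<subseteq> P" "dist (sum g F) (infsum g P) \<le> \<delta>"
    using infsum_finite_approximation[OF assms] by blast
  have "infsum g (F \<union> (P - F)) = infsum g F + infsum g (P - F)"
    using assms(1) F by (intro infsum_Un_disjoint) (auto intro: summable_on_subset)
  moreover have "F \<union> (P - F) = P"
    using F by blast
  ultimately have split: "infsum g P = sum g F + infsum g (P - F)"
    using F by simp
  then show thesis
    using F by (intro that) (auto simp: dist_real_def)
qed

lemma tagged_sum_abs_summable:
  fixes f :: "'a \<Rightarrow> real" and m :: "'a set \<Rightarrow> real"
  assumes "m summable_on P" "\<And>X. X \<in> P \<Longrightarrow> 0 \<le> m X" "\<And>X. X \<in> P \<Longrightarrow> \<bar>f (t X)\<bar> \<le> K"
  shows "(\<lambda>X. \<bar>f (t X) * m X\<bar>) summable_on P"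
    and "(\<lambda>X. f (t X) * m X) summable_on P"
    and "\<bar>\<Sum>\<^sub>\<infinity>X\<in>P. f (t X) * m X\<bar> \<le> K * infsum m P"
proof -
  have Km: "(\<lambda>X. K * m X) summable_on P"
    using assms(1) by (rule summable_on_cmult_right)
  have le: "\<bar>f (t X) * m X\<bar> \<le> K * m X" if "X \<in> P" for X
    using assms that by (auto simp: abs_mult intro: mult_right_mono)
  show abs: "(\<lambda>X. \<bar>f (t X) * m X\<bar>) summable_on P"
    using Km le by (intro summable_on_comparison_test[OF Km]) auto
  then show sums: "(\<lambda>X. f (t X) * m X) summable_on P"
    using abs_summable_summable[of "\<lambda>X. f (t X) * m X"] by simp
  have "norm (\<Sum>\<^sub>\<infinity>X\<in>P. f (t X) * m X) \<le> (\<Sum>\<^sub>\<infinity>X\<in>P. K * m X)"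
    using sums Km le by (intro norm_infsum_le[OF has_sum_infsum has_sum_infsum]) auto
  then show "\<bar>\<Sum>\<^sub>\<infinity>X\<in>P. f (t X) * m X\<bar> \<le> K * infsum m P"
    by (simp add: infsum_cmult_right')
qed

text \<open>The terms over the common part \<open>C\<close> cancel, and each remaining term is at most \<open>K * m X\<close>.\<close>

lemma tagged_sums_diff_le:
  fixes f :: "'a \<Rightarrow> real" and m :: "'a set \<Rightarrow> real"
  assumes summ: "m summable_on P" "m summable_on P'"
    and nonneg: "\<And>X. X \<in> P \<union> P' \<Longrightarrow> 0 \<le> m X"
    and bound: "\<And>X. X \<in> P \<union> P' \<Longrightarrow> \<bar>f (t X)\<bar> \<le> K"
    and C: "C \<subseteq> P" "C \<subseteq> P'"
  shows "\<bar>(\<Sum>\<^sub>\<infinity>X\<in>P. f (t X) * m X) - (\<Sum>\<^sub>\<infinity>X\<in>P'. f (t X) * m X)\<bar>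
         \<le> K * (infsum m (P - C) + infsum m (P' - C))"
proof -
  let ?s = "\<lambda>X. f (t X) * m X"
  have split: "infsum ?s Q = infsum ?s C + infsum ?s (Q - C) \<and>
               \<bar>infsum ?s (Q - C)\<bar> \<le> K * infsum m (Q - C)"
    if Q: "Q \<subseteq> P \<union> P'" "m summable_on Q" "C \<subseteq> Q" for Q
  proof -
    have s: "?s summable_on Q"
      using Q nonneg bound by (intro tagged_sum_abs_summable(2)) auto
    have "infsum ?s (C \<union> (Q - C)) = infsum ?s C + infsum ?s (Q - C)"
      using s Q by (intro infsum_Un_disjoint) (auto intro: summable_on_subset)
    moreover have "C \<union> (Q - C) = Q"
      using Q by blast
    moreover have "\<bar>infsum ?s (Q - C)\<bar> \<le> K * infsum m (Q - C)"
      using Q nonneg bound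
      by (intro tagged_sum_abs_summable(3)) (auto intro: summable_on_subset)
    ultimately show ?thesis by simp
  qed
  show ?thesis
    using split[of P] split[of P'] summ C by (auto simp: algebra_simps)
qed

section \<open>Subadditive set functions of finite variation\<close>

locale finite_variation_subadditive = sigma_algebra T \<A>
  for T :: "'a set" and \<A> :: "'a set set" +
  fixes m :: "'a set \<Rightarrow> real"
  assumes nonneg: "A \<in> \<A> \<Longrightarrow> 0 \<le> m A"
    and empty: "m {} = 0"
    and subadditive: "countably_subadditive \<A> (\<lambda>A. ennreal (m A))"
    and finite_var: "finite_variation T \<A> m"
begin

definition total_variation :: real where
  "total_variation = enn2real (variation \<A> m T)"

lemma variation_eq_total_variation: "variation \<A> m T = ennreal total_variation"
  using finite_var by (simp add: total_variation_def finite_variation_def less_top)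

lemma total_variation_nonneg: "0 \<le> total_variation"
  by (simp add: total_variation_def)

lemma sum_le_total_variation:
  assumes F: "finite F" "F \<subseteq> \<A>" "disjoint F"
  shows "sum m F \<le> total_variation"
proof -
  obtain h where h: "bij_betw h {..<card F} F"
    using ex_bij_betw_nat_finite[OF F(1)] by (auto simp: atLeast0LessThan)
  have mem: "h i \<in> F" if "i < card F" for i
    using h that by (auto simp: bij_betw_def)
  have "h i \<inter> h j = {}" if "i < card F" "j < card F" "i \<noteq> j" for i j
    using h that F(3) mem by (intro disjointD[of F]) (auto simp: bij_betw_def inj_on_def)
  then have disj: "disjoint_family_on h {..<card F}"
    by (auto simp: disjoint_family_on_def)
  have "ennreal (sum m F) = (\<Sum>i<card F. ennreal (m (h i)))"
    using F mem nonneg sum.reindex_bij_betw[OF h, of m] by (subst sum_ennreal) auto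
  also have "\<dots> \<le> variation \<A> m T"
    unfolding variation_def using disj mem F sets_into_space
    by (intro SUP_upper2[where i="(card F, h)"]) auto
  finally show ?thesis
    by (simp add: variation_eq_total_variation total_variation_nonneg)
qed

lemma summable_on_disjoint:
  assumes "P \<subseteq> \<A>" "disjoint P"
  shows "m summable_on P"
proof (rule nonneg_bdd_above_summable_on)
  show "bdd_above (sum m ` {F. F \<subseteq> P \<and> finite F})"
    using assms by (intro bdd_aboveI[where M=total_variation])
      (auto intro!: sum_le_total_variation intro: pairwise_subset)
qed (use assms nonneg in auto)

text \<open>
  \<open>\<sigma>\<close>-subadditivity speaks of sequences; a countable family of sets becomes a sequence by
  padding an injective numbering with the empty set, where \<open>m\<close> vanishes.
\<close>

lemma Union_le_infsum:
  assumes D: "countable D" "D \<subseteq> \<A>" "disjoint D"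
  shows "m (\<Union>D) \<le> infsum m D"
proof -
  define A where "A i = (if i \<in> to_nat_on D ` D then from_nat_into D i else {})" for i
  have A_to_nat: "A (to_nat_on D X) = X" if "X \<in> D" for X
    using that D by (simp add: A_def)
  have A_cases: "A i = {} \<or> (A i \<in> D \<and> to_nat_on D (A i) = i)" for i
    using A_to_nat by (cases "i \<in> to_nat_on D ` D") (auto simp: A_def D)
  have inj: "inj_on (to_nat_on D) D"
    using D(1) by (rule inj_on_to_nat_on)
  have range: "range A \<subseteq> \<A>"
  proof
    fix X assume "X \<in> range A"
    then obtain i where "X = A i" by blast
    then show "X \<in> \<A>"
      using A_cases[of i] D(2) by auto
  qed
  have disj: "disjoint_family A"
    unfolding disjoint_family_on_def
  proof (intro ballI impI)
    fix i j :: nat assume "i \<noteq> j"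
    then have "A i = {} \<or> A j = {} \<or> (A i \<in> D \<and> A j \<in> D \<and> A i \<noteq> A j)"
      using A_cases[of i] A_cases[of j] by metis
    then show "A i \<inter> A j = {}"
      using disjointD[OF D(3)] by auto
  qed
  have Union: "(\<Union>i. A i) = \<Union>D"
  proof
    show "(\<Union>i. A i) \<subseteq> \<Union>D"
    proof (rule UN_least)
      show "A i \<subseteq> \<Union>D" for i
        using A_cases[of i] by auto
    qed
    show "\<Union>D \<subseteq> (\<Union>i. A i)"
    proof (rule Union_least)
      show "X \<subseteq> (\<Union>i. A i)" if "X \<in> D" for X
        using A_to_nat[OF that] by (metis UNIV_I UN_upper)
    qed
  qed
  have "(m has_sum infsum m D) D"
    using summable_on_disjoint D by (intro has_sum_infsum) auto
  then have "((m \<circ> A \<circ> to_nat_on D) has_sum infsum m D) D"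
    by (rule has_sum_cong[THEN iffD1, rotated]) (simp add: A_to_nat)
  then have "((m \<circ> A) has_sum infsum m D) (to_nat_on D ` D)"
    by (simp add: has_sum_reindex[OF inj])
  then have "((m \<circ> A) has_sum infsum m D) UNIV"
    by (rule has_sum_cong_neutral[THEN iffD1, rotated -1]) (auto simp: A_def empty)
  then have sums: "(\<lambda>i. m (A i)) sums infsum m D"
    by (drule_tac has_sum_imp_sums) (simp add: o_def)
  have "ennreal (m (\<Union>D)) \<le> (\<Sum>i. ennreal (m (A i)))"
    using subadditive[unfolded countably_subadditive_def, rule_format, OF range disj]
      countable_Union[OF D(1,2)] by (simp add: Union)
  also have "\<dots> = ennreal (infsum m D)"
    using sums range nonneg by (intro suminf_ennreal_eq) auto
  finally show ?thesis
    using D nonneg by (subst (asm) ennreal_le_iff) (auto intro: infsum_nonneg)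
qed

text \<open>
  Disjointness of \<open>B\<close> ensures that no member of \<open>D\<close> is merged twice; members inside no set of
  \<open>B\<close> are simply lost.
\<close>

lemma sum_merged_le:
  assumes D: "countable D" "D \<subseteq> \<A>" "disjoint D" "{} \<notin> D"
    and B: "finite B" "disjoint B"
  shows "(\<Sum>Y\<in>B. m (\<Union>{X\<in>D. X \<subseteq> Y})) \<le> infsum m D"
proof -
  let ?D = "\<lambda>Y. {X\<in>D. X \<subseteq> Y}"
  have summ: "m summable_on E" if "E \<subseteq> D" for E
    using that D by (intro summable_on_disjoint) (auto intro: pairwise_subset)
  have "(\<Sum>Y\<in>B. m (\<Union>(?D Y))) \<le> (\<Sum>Y\<in>B. infsum m (?D Y))"
    using D by (intro sum_mono Union_le_infsum) (auto intro: pairwise_subset countable_subset)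
  also have "\<dots> = infsum m (\<Union>Y\<in>B. ?D Y)"
  proof (rule sum_infsum)
    fix Y Z assume "Y \<in> B" "Z \<in> B" "Y \<noteq> Z"
    then have "Y \<inter> Z = {}"
      using B by (auto simp: disjoint_def)
    \<comment> \<open>A nonempty set cannot lie in two disjoint sets.\<close>
    then show "?D Y \<inter> ?D Z = {}"
      using D(4) by auto (metis inf.bounded_iff subset_empty)
  qed (use B summ in auto)
  also have "\<dots> \<le> infsum m D"
    using D nonneg by (intro infsum_mono2 summ) auto
  finally show ?thesis .
qed

text \<open>
  The variation is a supremum over disjoint families; a nearly optimal one becomes a partition
  by dropping empty sets, where \<open>m\<close> vanishes, and adding the complement of its union.
\<close>

lemma finite_partition_near_variation:
  assumes "\<delta> > 0"
  obtains Q where "finite_partition T \<A> Q" "total_variation - \<delta> < sum m Q"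
proof -
  have "\<exists>(n::nat) X. (\<forall>i<n. X i \<in> \<A> \<and> X i \<subseteq> T) \<and> disjoint_family_on X {..<n} \<and>
              total_variation - \<delta> < (\<Sum>i<n. m (X i))"
  proof (cases "total_variation - \<delta> < 0")
    case True
    then show ?thesis
      by (intro exI[of _ 0]) (auto simp: disjoint_family_on_def)
  next
    case False
    then have "ennreal (total_variation - \<delta>) < variation \<A> m T"
      using assms by (simp add: variation_eq_total_variation ennreal_less_iff)
    then obtain n :: nat and X where X: "\<forall>i<n. X i \<in> \<A> \<and> X i \<subseteq> T" "disjoint_family_on X {..<n}"
        "ennreal (total_variation - \<delta>) < (\<Sum>i<n. ennreal (m (X i)))"
      unfolding variation_def less_SUP_iff by auto
    moreover have "(\<Sum>i<n. ennreal (m (X i))) = ennreal (\<Sum>i<n. m (X i))"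
      using X nonneg by (intro sum_ennreal) auto
    ultimately show ?thesis
      using False by (auto simp: ennreal_less_iff intro!: exI[of _ n] exI[of _ X])
  qed
  then obtain n :: nat and X where X: "\<And>i. i < n \<Longrightarrow> X i \<in> \<A>" "disjoint_family_on X {..<n}"
      "total_variation - \<delta> < (\<Sum>i<n. m (X i))"
    by blast
  define G where "G = X ` {..<n} - {{}}"
  define Q where "Q = G \<union> ({T - \<Union>G} - {{}})"
  have "disjoint (X ` {..<n})"
    using X(2) by (rule disjoint_family_on_disjoint_image)
  then have G: "G \<subseteq> \<A>" "finite G" "disjoint G"
    using X(1) by (auto simp: G_def intro: pairwise_subset)
  then have diff: "T - \<Union>G \<in> \<A>"
    by (intro Diff finite_Union) auto
  have part: "finite_partition T \<A> Q"
  proof -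
    have "\<Union>G \<subseteq> T"
      using G(1) sets_into_space by blast
    then have "\<Union>Q = T"
      by (auto simp: Q_def)
    moreover have "disjoint Q"
      unfolding Q_def using G(3) by (intro disjoint_union) (auto simp: pairwise_def)
    moreover have "{} \<notin> Q"
      by (auto simp: Q_def G_def)
    ultimately show ?thesis
      using G diff by (auto simp: finite_partition_def partition_on_def Q_def)
  qed
  have "(\<Sum>i<n. m (X i)) = (\<Sum>i\<in>{i. i < n \<and> X i \<noteq> {}}. m (X i))"
    by (rule sum.mono_neutral_right) (auto simp: empty)
  also have "\<dots> = sum m (X ` {i. i < n \<and> X i \<noteq> {}})"
    using X(2) by (subst sum.reindex) (auto simp: inj_on_def disjoint_family_on_def)
  also have "X ` {i. i < n \<and> X i \<noteq> {}} = G"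
    by (auto simp: G_def)
  also have "sum m G \<le> sum m Q"
    using G diff nonneg by (intro sum_mono2) (auto simp: Q_def)
  finally show thesis
    using X(3) part that by force
qed

lemma sum_le_infsum_refinement:
  assumes "finite_partition T \<A> Q" "countable_partition T \<A> R" "refines T R Q"
  shows "sum m Q \<le> infsum m R"
proof -
  have "Y = \<Union>{X\<in>R. X \<subseteq> Y}" if "Y \<in> Q" for Y
    using refines_obtains_subset[OF assms(3) that] by (simp add: partition_on_def)
  then have "sum m Q = (\<Sum>Y\<in>Q. m (\<Union>{X\<in>R. X \<subseteq> Y}))"
    by (intro sum.cong) auto
  also have "\<dots> \<le> infsum m R"
    using assms by (intro sum_merged_le)
      (auto simp: finite_partition_def countable_partition_def partition_on_def)
  finally show ?thesis .
qed

text \<open>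
  The common refinement with a finite partition whose sum is close to the variation has at
  least that sum.
\<close>

lemma refinement_near_variation:
  assumes P: "countable_partition T \<A> P" and "\<delta> > 0"
  obtains R where "countable_partition T \<A> R" "refines T R P" "total_variation - \<delta> < infsum m R"
proof -
  obtain Q where Q: "finite_partition T \<A> Q" "total_variation - \<delta> < sum m Q"
    using finite_partition_near_variation[OF \<open>\<delta> > 0\<close>] by blast
  have parts: "\<And>S. S \<in> {P, Q} \<Longrightarrow> partition_on T S"
    using P Q by (auto simp: countable_partition_def finite_partition_def)
  define R where "R = common_refinement {P, Q}"
  have "R \<subseteq> (\<lambda>(X, Y). X \<inter> Y) ` (P \<times> Q)"
    unfolding R_def common_refinement by force
  moreover have "countable ((\<lambda>(X, Y). X \<inter> Y) ` (P \<times> Q))"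
    using P Q by (intro countable_image countable_SIGMA)
      (auto simp: countable_partition_def finite_partition_def countable_finite)
  moreover have "(\<lambda>(X, Y). X \<inter> Y) ` (P \<times> Q) \<subseteq> \<A>"
    using P Q by (auto simp: countable_partition_def finite_partition_def)
  moreover have "partition_on T R"
    unfolding R_def using parts by (intro partition_on_common_refinement) auto
  ultimately have R: "countable_partition T \<A> R"
    unfolding countable_partition_def by (meson countable_subset order_trans)
  moreover have "refines T R P" "refines T R Q"
    unfolding R_def using parts by (auto intro!: refines_common_refinement)
  ultimately show thesis
    using sum_le_infsum_refinement[OF Q(1) R] Q(2) that by force
qed

section \<open>Equivalence of the two integrals\<close>

lemma has_gould_imp_has_RL:
  assumes f: "\<And>x. x \<in> T \<Longrightarrow> \<bar>f x\<bar> \<le> K" and K: "K > 0"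
    and gould: "has_gould_integral T \<A> m f a"
  shows "has_RL_integral T \<A> m f a"
  unfolding has_RL_integral_def
proof (intro allI impI)
  fix \<epsilon> :: real assume "\<epsilon> > 0"
  then have "\<epsilon> / 2 > 0" by simp
  then obtain Q where Q: "finite_partition T \<A> Q" and
    Q_close: "\<forall>P. finite_partition T \<A> P \<and> refines T P Q \<longrightarrow>
                (\<forall>t. (\<forall>X\<in>P. t X \<in> X) \<longrightarrow> \<bar>(\<Sum>X\<in>P. f (t X) * m X) - a\<bar> < \<epsilon> / 2)"
    using gould unfolding has_gould_integral_def by meson
  have goal: "(\<lambda>X. \<bar>f (t X) * m X\<bar>) summable_on P \<and> \<bar>(\<Sum>\<^sub>\<infinity>X\<in>P. f (t X) * m X) - a\<bar> < \<epsilon>"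
    if P: "countable_partition T \<A> P" "refines T P Q" and t: "\<forall>X\<in>P. t X \<in> X" for P t
  proof -
    have P': "P \<subseteq> \<A>" "disjoint P" "{} \<notin> P" "countable P" "\<Union>P = T"
      using P by (auto simp: countable_partition_def partition_on_def)
    have Q': "Q \<subseteq> \<A>" "disjoint Q" "finite Q"
      using Q by (auto simp: finite_partition_def partition_on_def)
    have summ: "m summable_on P"
      using P' by (intro summable_on_disjoint)
    \<comment> \<open>The tail is paid for twice, before and after merging, at rate \<open>K\<close>.\<close>
    obtain F where F: "finite F" "F \<subseteq> P" "infsum m (P - F) \<le> \<epsilon> / (8 * K)"
      using summable_on_small_tail[OF summ, of "\<epsilon> / (8 * K)"] \<open>\<epsilon> > 0\<close> K by auto
    define rest where "rest Y = \<Union>{X\<in>P - F. X \<subseteq> Y}" for Y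
    define G where "G = rest ` Q - {{}}"
    define P\<^sub>F where "P\<^sub>F = F \<union> G"
    have rest_sets: "rest Y \<in> \<A>" for Y
      unfolding rest_def using P' by (intro countable_Union) (auto intro: countable_subset)
    have Un_G: "\<Union>G = \<Union>(P - F)"
    proof
      show "\<Union>(P - F) \<subseteq> \<Union>G"
      proof
        fix x assume "x \<in> \<Union>(P - F)"
        then obtain X where X: "X \<in> P - F" "x \<in> X" by blast
        then obtain Y where Y: "Y \<in> Q" "X \<subseteq> Y"
          using P(2) by (auto simp: refines_def)
        then have "x \<in> rest Y"
          using X by (auto simp: rest_def)
        then show "x \<in> \<Union>G"
          using Y(1) by (auto simp: G_def)
      qed
    qed (auto simp: G_def rest_def)
    have G_disj: "disjoint G"
    proof (rule disjointI)
      fix A B assume "A \<in> G" "B \<in> G" "A \<noteq> B"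
      then obtain Y Z where YZ: "Y \<in> Q" "Z \<in> Q" "A = rest Y" "B = rest Z" "Y \<noteq> Z"
        by (auto simp: G_def)
      then have "Y \<inter> Z = {}"
        using disjointD[OF Q'(2)] by blast
      moreover have "A \<subseteq> Y" "B \<subseteq> Z"
        using YZ by (auto simp: rest_def)
      ultimately show "A \<inter> B = {}" by blast
    qed
    have FG: "\<Union>F \<inter> \<Union>G = {}"
      using disjoint_Union_Diff[OF P'(2) F(2)] by (simp add: Un_G)
    have "disjoint (F \<union> G)"
      using P'(2) F(2) G_disj FG by (intro disjoint_union) (auto intro: pairwise_subset)
    moreover have "\<Union>(F \<union> G) = T"
      using P'(5) F(2) Un_G by auto
    moreover have "{} \<notin> F \<union> G"
      using P'(3) F(2) by (auto simp: G_def)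
    ultimately have part: "partition_on T P\<^sub>F"
      by (simp add: partition_on_def P\<^sub>F_def)
    have P\<^sub>F: "finite_partition T \<A> P\<^sub>F"
      using part F P' Q' rest_sets by (auto simp: finite_partition_def P\<^sub>F_def G_def)
    have ref: "refines T P\<^sub>F Q"
    proof -
      have "\<exists>Y\<in>Q. X \<subseteq> Y" if "X \<in> P\<^sub>F" for X
        using that P(2) F(2) by (auto simp: refines_def P\<^sub>F_def G_def rest_def)
      then show ?thesis
        using part P(2) by (simp add: refines_def)
    qed
    have "infsum m (P\<^sub>F - F) \<le> infsum m (P - F)"
    proof -
      have "infsum m (P\<^sub>F - F) = sum m (P\<^sub>F - F)"
        using F Q' by (intro infsum_finite) (auto simp: P\<^sub>F_def G_def)
      also have "\<dots> \<le> sum m (rest ` Q)"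
        using Q' rest_sets nonneg by (intro sum_mono2) (auto simp: P\<^sub>F_def G_def)
      also have "\<dots> \<le> sum (m \<circ> rest) Q"
        using Q' rest_sets nonneg by (intro sum_image_le) auto
      also have "\<dots> \<le> infsum m (P - F)"
        unfolding rest_def o_def using P' Q'
        by (intro sum_merged_le) (auto intro: pairwise_subset)
      finally show ?thesis .
    qed
    then have tails: "infsum m (P - F) + infsum m (P\<^sub>F - F) \<le> \<epsilon> / (4 * K)"
      using F(3) by simp
    \<comment> \<open>One tag function for both families, so that the sums agree on the sets they share.\<close>
    define t' where "t' X = (if X \<in> P then t X else SOME x. x \<in> X)" for X
    have t': "t' X \<in> X" if "X \<in> P \<union> P\<^sub>F" for X
      using that t part by (auto simp: t'_def partition_on_def intro!: some_in_eq[THEN iffD2])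
    have in_T: "X \<in> \<A> \<and> t' X \<in> T" if "X \<in> P \<union> P\<^sub>F" for X
      using that t'[OF that] P' P\<^sub>F sets_into_space by (auto simp: finite_partition_def)
    have "\<bar>(\<Sum>\<^sub>\<infinity>X\<in>P. f (t' X) * m X) - (\<Sum>\<^sub>\<infinity>X\<in>P\<^sub>F. f (t' X) * m X)\<bar>
          \<le> K * (infsum m (P - F) + infsum m (P\<^sub>F - F))"
      using F(1,2) summ P\<^sub>F in_T nonneg f
      by (intro tagged_sums_diff_le) (auto simp: P\<^sub>F_def finite_partition_def)
    also have "\<dots> \<le> K * (\<epsilon> / (4 * K))"
      using tails K by (intro mult_left_mono) auto
    also have "\<dots> = \<epsilon> / 4"
      using K by simp
    finally have "\<bar>(\<Sum>\<^sub>\<infinity>X\<in>P. f (t' X) * m X) - (\<Sum>X\<in>P\<^sub>F. f (t' X) * m X)\<bar> \<le> \<epsilon> / 4"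
      using P\<^sub>F by (simp add: finite_partition_def)
    moreover have "\<bar>(\<Sum>X\<in>P\<^sub>F. f (t' X) * m X) - a\<bar> < \<epsilon> / 2"
      using P\<^sub>F ref t' by (intro Q_close[rule_format]) auto
    moreover have "(\<Sum>\<^sub>\<infinity>X\<in>P. f (t' X) * m X) = (\<Sum>\<^sub>\<infinity>X\<in>P. f (t X) * m X)"
      by (intro infsum_cong) (simp add: t'_def)
    ultimately have "\<bar>(\<Sum>\<^sub>\<infinity>X\<in>P. f (t X) * m X) - a\<bar> < \<epsilon>"
      using \<open>\<epsilon> > 0\<close> by linarith
    moreover have "(\<lambda>X. \<bar>f (t X) * m X\<bar>) summable_on P"
    proof (rule tagged_sum_abs_summable(1)[OF summ])
      fix X assume X: "X \<in> P"
      then show "0 \<le> m X"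
        using P'(1) nonneg by blast
      have "t X \<in> T"
        using in_T[of X] X by (simp add: t'_def)
      then show "\<bar>f (t X)\<bar> \<le> K"
        by (rule f)
    qed
    ultimately show ?thesis by blast
  qed
  have bdd: "bounded (f ` X)" if "X \<subseteq> T" for X
    using f that by (auto simp: bounded_iff intro!: exI[of _ K])
  have "countable_partition T \<A> Q"
    using Q by (auto simp: finite_partition_def countable_partition_def countable_finite)
  moreover have "bounded (f ` X)" if "countable_partition T \<A> P" "X \<in> P" for P X
    using that by (intro bdd) (auto simp: countable_partition_def partition_on_def)
  ultimately show "\<exists>P\<^sub>\<epsilon>. countable_partition T \<A> P\<^sub>\<epsilon> \<and>
        (\<forall>P. countable_partition T \<A> P \<and> refines T P P\<^sub>\<epsilon> \<longrightarrow>
          (\<forall>X\<in>P. m X > 0 \<longrightarrow> bounded (f ` X)) \<and>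
          (\<forall>t. (\<forall>X\<in>P. t X \<in> X) \<longrightarrow>
             (\<lambda>X. \<bar>f (t X) * m X\<bar>) summable_on P \<and>
             \<bar>(\<Sum>\<^sub>\<infinity>X\<in>P. f (t X) * m X) - a\<bar> < \<epsilon>))"
    using goal by (intro exI[of _ Q] conjI allI impI ballI) blast+
qed

lemma has_RL_imp_has_gould:
  assumes f: "\<And>x. x \<in> T \<Longrightarrow> \<bar>f x\<bar> \<le> K" and K: "K > 0"
    and RL: "has_RL_integral T \<A> m f a"
  shows "has_gould_integral T \<A> m f a"
  unfolding has_gould_integral_def
proof (intro allI impI)
  fix \<epsilon> :: real assume "\<epsilon> > 0"
  then have "\<epsilon> / 2 > 0" by simp
  then obtain Q0 where Q0: "countable_partition T \<A> Q0" and
    Q0_close: "\<forall>P. countable_partition T \<A> P \<and> refines T P Q0 \<longrightarrow>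
                (\<forall>t. (\<forall>X\<in>P. t X \<in> X) \<longrightarrow> \<bar>(\<Sum>\<^sub>\<infinity>X\<in>P. f (t X) * m X) - a\<bar> < \<epsilon> / 2)"
    using RL unfolding has_RL_integral_def by meson
  \<comment> \<open>The sums compared below differ by \<open>3 * \<delta> * K\<close> at most: a tail of weight at most \<open>\<delta>\<close>
      takes the place of sets of total weight at most \<open>2 * \<delta>\<close>.\<close>
  define \<delta> where "\<delta> = \<epsilon> / (8 * K)"
  have "\<delta> > 0"
    using \<open>\<epsilon> > 0\<close> K by (simp add: \<delta>_def)
  obtain Q where Q: "countable_partition T \<A> Q" "refines T Q Q0"
      "total_variation - \<delta> < infsum m Q"
    using refinement_near_variation[OF Q0 \<open>\<delta> > 0\<close>] by blast
  have Q': "Q \<subseteq> \<A>" "disjoint Q" "{} \<notin> Q" "countable Q" "\<Union>Q = T"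
    using Q by (auto simp: countable_partition_def partition_on_def)
  have summ: "m summable_on Q"
    using Q' by (intro summable_on_disjoint)
  obtain F where F: "finite F" "F \<subseteq> Q" "infsum m (Q - F) \<le> \<delta>"
      "infsum m Q = sum m F + infsum m (Q - F)"
    using summable_on_small_tail[OF summ \<open>\<delta> > 0\<close>] by auto
  define R where "R = \<Union>(Q - F)"
  have FR: "\<Union>F \<inter> R = {}"
    using disjoint_Union_Diff[OF Q'(2) F(2)] by (simp add: R_def)
  have F': "F \<subseteq> \<A>" "disjoint F"
    using F Q' by (auto intro: pairwise_subset)
  \<comment> \<open>Adjoined to \<open>F\<close>, a disjoint family inside \<open>R\<close> cannot exceed the total variation, of which
      \<open>F\<close> already has all but \<open>2 * \<delta>\<close>.\<close>
  have small: "sum m G \<le> 2 * \<delta>"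
    if G: "finite G" "G \<subseteq> \<A>" "disjoint G" "{} \<notin> G" "\<Union>G \<subseteq> R" for G
  proof -
    have FG: "\<Union>F \<inter> \<Union>G = {}"
      using FR G(5) by blast
    have "F \<inter> G = {}"
    proof (rule equals0I)
      fix X assume "X \<in> F \<inter> G"
      then have "X \<in> G" "X \<subseteq> \<Union>F \<inter> \<Union>G" by blast+
      then show False
        using FG G(4) by auto
    qed
    then have "sum m F + sum m G = sum m (F \<union> G)"
      using F(1) G(1) by (simp add: sum.union_disjoint)
    also have "\<dots> \<le> total_variation"
      using F(1) F' G FG by (intro sum_le_total_variation disjoint_union) auto
    finally show ?thesis
      using F(3,4) Q(3) by linarith
  qed
  define Q\<^sub>F where "Q\<^sub>F = F \<union> ({R} - {{}})"
  have R: "R \<in> \<A>"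
    unfolding R_def using Q' by (intro countable_Union) auto
  have Q\<^sub>F: "finite_partition T \<A> Q\<^sub>F"
  proof -
    have Un_R: "\<Union>({R} - {{}}) = R" by auto
    have "\<Union>Q\<^sub>F = T"
      using Union_Un_Union_Diff[OF F(2)] Q'(5) by (simp add: Q\<^sub>F_def Un_R flip: R_def)
    moreover have "disjoint Q\<^sub>F"
      unfolding Q\<^sub>F_def
    proof (rule disjoint_union[OF F'(2)])
      show "\<Union>F \<inter> \<Union>({R} - {{}}) = {}"
        using FR by (simp add: Un_R)
    qed (simp add: pairwise_def)
    ultimately show ?thesis
      using F F' Q'(3) R by (auto simp: finite_partition_def partition_on_def Q\<^sub>F_def)
  qed
  have goal: "\<bar>(\<Sum>X\<in>P. f (t X) * m X) - a\<bar> < \<epsilon>"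
    if P: "finite_partition T \<A> P" "refines T P Q\<^sub>F" and t: "\<forall>X\<in>P. t X \<in> X" for P t
  proof -
    have P': "P \<subseteq> \<A>" "disjoint P" "{} \<notin> P" "finite P" "\<Union>P = T"
      using P by (auto simp: finite_partition_def partition_on_def)
    \<comment> \<open>Undoing the merge: the members of \<open>P\<close> inside \<open>R\<close> give way to the tail of \<open>Q\<close>.\<close>
    define C where "C = {X\<in>P. \<exists>Y\<in>F. X \<subseteq> Y}"
    define P2 where "P2 = C \<union> (Q - F)"
    have cases: "X \<in> C \<or> X \<subseteq> R" if "X \<in> P" for X
      using P(2) that by (force simp: refines_def Q\<^sub>F_def C_def)
    have Un_C: "\<Union>C = \<Union>F"
    proof
      show "\<Union>F \<subseteq> \<Union>C"
      proof
        fix x assume x: "x \<in> \<Union>F"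
        then obtain X where X: "X \<in> P" "x \<in> X"
          using F(2) Q'(5) P'(5) by blast
        with x FR cases[OF X(1)] show "x \<in> \<Union>C" by blast
      qed
    qed (auto simp: C_def)
    have C_R: "\<Union>C \<inter> \<Union>(Q - F) = {}"
      using FR by (simp add: Un_C R_def)
    have part: "partition_on T P2"
    proof -
      have "disjoint C" "disjoint (Q - F)"
        using P'(2) Q'(2) by (auto simp: C_def intro: pairwise_subset)
      then have "disjoint P2"
        unfolding P2_def using C_R by (intro disjoint_union)
      moreover have "\<Union>P2 = T"
        using Union_Un_Union_Diff[OF F(2)] Un_C Q'(5) by (simp add: P2_def)
      ultimately show ?thesis
        using P'(3) Q'(3) by (auto simp: partition_on_def P2_def C_def)
    qed
    have P2: "countable_partition T \<A> P2"
      using part P' Q' by (auto simp: countable_partition_def P2_def C_def countable_finite)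
    have "refines T P2 Q"
    proof -
      have "\<exists>Y\<in>Q. X \<subseteq> Y" if "X \<in> P2" for X
        using that F(2) by (auto simp: P2_def C_def)
      then show ?thesis
        using part Q(1) by (simp add: refines_def countable_partition_def)
    qed
    then have ref: "refines T P2 Q0"
      using Q(2) by (rule refines_trans)
    have summ2: "m summable_on P2"
      using P2 by (intro summable_on_disjoint) (auto simp: countable_partition_def partition_on_def)
    have "infsum m (P - C) \<le> 2 * \<delta>"
    proof -
      have "sum m (P - C) \<le> 2 * \<delta>"
        using P' cases by (intro small) (auto intro: pairwise_subset)
      then show ?thesis using P' by simp
    qed
    moreover have "infsum m (P2 - C) \<le> \<delta>"
    proof -
      have "infsum m (P2 - C) \<le> infsum m (Q - F)"
        using summ summ2 Q'(1) nonneg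
        by (intro infsum_mono2) (auto simp: P2_def intro: summable_on_subset)
      then show ?thesis using F(3) by simp
    qed
    ultimately have tails: "infsum m (P - C) + infsum m (P2 - C) \<le> 3 * \<delta>"
      by simp
    \<comment> \<open>One tag function for both families, so that the sums agree on the sets they share.\<close>
    define t' where "t' X = (if X \<in> P then t X else SOME x. x \<in> X)" for X
    have t': "t' X \<in> X" if "X \<in> P \<union> P2" for X
      using that t part by (auto simp: t'_def partition_on_def intro!: some_in_eq[THEN iffD2])
    have in_T: "X \<in> \<A> \<and> t' X \<in> T" if "X \<in> P \<union> P2" for X
      using that t'[OF that] P' P2 sets_into_space by (auto simp: countable_partition_def)
    have "\<bar>(\<Sum>\<^sub>\<infinity>X\<in>P. f (t' X) * m X) - (\<Sum>\<^sub>\<infinity>X\<in>P2. f (t' X) * m X)\<bar>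
          \<le> K * (infsum m (P - C) + infsum m (P2 - C))"
      using P'(4) summ2 in_T nonneg f
      by (intro tagged_sums_diff_le) (auto simp: P2_def C_def)
    also have "\<dots> \<le> K * (3 * \<delta>)"
      using tails K by (intro mult_left_mono) auto
    also have "\<dots> = 3 * \<epsilon> / 8"
      using K by (simp add: \<delta>_def)
    finally have "\<bar>(\<Sum>X\<in>P. f (t' X) * m X) - (\<Sum>\<^sub>\<infinity>X\<in>P2. f (t' X) * m X)\<bar> \<le> 3 * \<epsilon> / 8"
      using P' by simp
    moreover have "\<bar>(\<Sum>\<^sub>\<infinity>X\<in>P2. f (t' X) * m X) - a\<bar> < \<epsilon> / 2"
      using P2 ref t' by (intro Q0_close[rule_format]) auto
    moreover have "(\<Sum>X\<in>P. f (t' X) * m X) = (\<Sum>X\<in>P. f (t X) * m X)"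
      by (intro sum.cong) (simp_all add: t'_def)
    ultimately show ?thesis
      using \<open>\<epsilon> > 0\<close> by linarith
  qed
  show "\<exists>P\<^sub>\<epsilon>. finite_partition T \<A> P\<^sub>\<epsilon> \<and>
        (\<forall>P. finite_partition T \<A> P \<and> refines T P P\<^sub>\<epsilon> \<longrightarrow>
          (\<forall>t. (\<forall>X\<in>P. t X \<in> X) \<longrightarrow> \<bar>(\<Sum>X\<in>P. f (t X) * m X) - a\<bar> < \<epsilon>))"
    using Q\<^sub>F goal by blast
qed

end

theorem theorem4p7:
  fixes T :: "'a set" and \<A> :: "'a set set"
    and m :: "'a set \<Rightarrow> real" and f :: "'a \<Rightarrow> real"
  assumes "infinite T"
    and "sigma_algebra T \<A>"
    and "\<And>A. A \<in> \<A> \<Longrightarrow> 0 \<le> m A"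
    and "m {} = 0"
    and "increasing \<A> m"
    and "countably_subadditive \<A> (\<lambda>A. ennreal (m A))"
    and "finite_variation T \<A> m"
    and "bounded (f ` T)"
  shows "(gould_integrable T \<A> m f \<longleftrightarrow> RL_integrable T \<A> m f) \<and>
         (gould_integrable T \<A> m f \<longrightarrow> gould_integral T \<A> m f = RL_integral T \<A> m f)"
proof -
  interpret sigma_algebra T \<A> by fact
  interpret finite_variation_subadditive T \<A> m
    by unfold_locales (use assms in auto)
  obtain K where K: "K > 0" "\<And>x. x \<in> T \<Longrightarrow> \<bar>f x\<bar> \<le> K"
    using assms(8) unfolding bounded_pos by auto
  have "has_gould_integral T \<A> m f = has_RL_integral T \<A> m f"
    using has_gould_imp_has_RL[where f=f, OF K(2,1)] has_RL_imp_has_gould[where f=f, OF K(2,1)]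
    by blast
  then show ?thesis
    by (simp add: gould_integrable_def RL_integrable_def gould_integral_def RL_integral_def)
qed

end
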